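(* Mode-target games can be solved by the symbolic algorithm $\mathbf{GR(1)\text{-}Emb}$ using $O\left(m\max_it_i\,n^2\right)$ $\mathrm{Pre}$ computations. That is, given a mode-target game $(G,\varphi)$ with $n$ states, $m$ modes, and $t_i$ targets for mode $i$, the winning set $\llbracket\varphi\rrbracket$ of player 0 can be computed by iterative evaluation of the fixed-point expression $$\nu Z\left(\bigcap_{i=1}^m\mu Y\bigcup_{j=1}^{\max_it_i}\nu X\Big(\big(\mathrm{Pre}(X)\cap\bigcup_{\ell=1}^m\llbracket M_\ell\wedge\bar T_{\ell,j}\rrbracket\big)\cup\mathrm{Pre}(Y)\cup\big(\llbracket\neg M_i\rrbracket\cap\mathrm{Pre}(Z)\big)\Big)\right)$$ using $O\left(m\max_it_i\,n^2\right)$ evaluations of the operator $\mathrm{Pre}$, where $\bar T_{i,j}=T_{i,j}$ if $j\le t_i$ and $\bar T_{i,j}=\mathtt{false}$ otherwise.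
   Context: LTL: over a set $P$ of atomic propositions, formulas are built from $p\in P$, $\neg$, $\vee$, $\bigcirc$ (next), $\mathcal U$ (until), with the usual semantics over infinite words in $(2^P)^\omega$; $\wedge$, $\implies$, $\Diamond$ (eventually), $\square$ (always) are the usual abbreviations. $W(\varphi)$ is the set of infinite words satisfying $\varphi$ at time 0. Games: a game graph $G=(V,E,P,L)$ has a finite state set $V=V_0\sqcup V_1$ (player $k$ moves at states of $V_k$), a transition relation $E\subseteq V\times V$ such that every state has at least one successor, a finite set $P$ of atomic propositions and a labeling $L:V\to2^P$, extended letterwise to infinite sequences. A play is an infinite sequence $v_0v_1\ldots$ with $(v_i,v_{i+1})\in E$ for all $i$. An LTL game is a pair $(G,\varphi)$ with $\varphi$ an LTL formula. A strategy for player 0 is a partial function $f:V^*\times V_0\to V$ with $(v,f(r,v))\in E$ whenever defined ($r$ is the past history, $v$ the current state). It is winning from $v$ if it is defined at every player-0 position reached from $v$ while following it and every play $r$ from $v$ following $f$ satisfies $L(r)\in W(\varphi)$. $\llbracket\varphi\rrbracket$ is the set of states from which player 0 has a winning strategy; for a positional formula (no temporal operators) this is the set of states whose label satisfies it. $\mathrm{Pre}(V')=\{v\in V_0:\exists v'\in V',\ (v,v')\in E\}\cup\{v\in V_1:\forall v'\in V,\ (v,v')\in E\Rightarrow v'\in V'\}$. For monotone $F:2^V\to2^V$: $\nu X F(X)=\bigcap_iX_i$ with $X_0=V$, $X_{i+1}=F(X_i)$; $\mu XF(X)=\bigcup_iX_i$ with $X_0=\varnothing$, $X_{i+1}=F(X_i)$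 (greatest and least fixed points). Mode-target (MT) game: an LTL game $(G,\varphi)$ where $G=(V,E,M\cup T,L)$, $M=\{M_1,\dots,M_m\}$ (modes), $T=\bigcup_iT_i$, $T_i=\{T_{i,1},\dots,T_{i,t_i}\}$ (targets of mode $i$) are finite sets of atomic propositions, the modes are mutually exclusive ($M_i\in L(v)\Rightarrow M_j\notin L(v)$ for all $j\ne i$ and $v\in V$), and $\varphi=\bigwedge_{i=1}^m\left(\Diamond\square M_i\implies\bigvee_{j=1}^{t_i}\Diamond\square T_{i,j}\right)$. A symbolic algorithm manipulates subsets of $V$ by Boolean set operations and the operator $\mathrm{Pre}$; its cost is counted as the number of $\mathrm{Pre}$ evaluations. Algorithm $\mathbf{GR(1)\text{-}Emb}$ is the iterative evaluation of the displayed fixed-point expression; during the evaluation, intermediate values computed earlier may be stored and, when monotonicity permits, used to initialize later inner fixed-point computations. To solve the game means to compute $\llbracket\varphi\rrbracket$. *)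

theory Defs
  imports Main "HOL-Library.Monad_Syntax"
begin

section \<open>Linear temporal logic\<close>

text \<open>
  \<open>TT\<close> (true) is a constructor rather than an abbreviation \<open>p \<or> \<not> p\<close>, so that no
  atomic proposition has to be chosen for it and so that empty conjunctions and disjunctions exist.
\<close>

datatype (atoms: 'p) ltl =
    TT
  | Atom 'p
  | Neg "'p ltl"
  | Disj "'p ltl" "'p ltl"
  | Next "'p ltl"
  | Until "'p ltl" "'p ltl"

abbreviation FF :: "'p ltl" where "FF \<equiv> Neg TT"
abbreviation Conj :: "'p ltl \<Rightarrow> 'p ltl \<Rightarrow> 'p ltl" where "Conj a b \<equiv> Neg (Disj (Neg a) (Neg b))"
abbreviation Impl :: "'p ltl \<Rightarrow> 'p ltl \<Rightarrow> 'p ltl" where "Impl a b \<equiv> Disj (Neg a) b"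
abbreviation Eventually :: "'p ltl \<Rightarrow> 'p ltl" where "Eventually a \<equiv> Until TT a"
abbreviation Always :: "'p ltl \<Rightarrow> 'p ltl" where "Always a \<equiv> Neg (Eventually (Neg a))"

definition Conjs :: "'p ltl list \<Rightarrow> 'p ltl" where "Conjs as = foldr Conj as TT"
definition Disjs :: "'p ltl list \<Rightarrow> 'p ltl" where "Disjs as = foldr Disj as FF"

primrec sat :: "(nat \<Rightarrow> 'p set) \<Rightarrow> nat \<Rightarrow> 'p ltl \<Rightarrow> bool" where
  "sat w i TT \<longleftrightarrow> True"
| "sat w i (Atom p) \<longleftrightarrow> p \<in> w i"
| "sat w i (Neg a) \<longleftrightarrow> \<not> sat w i a"
| "sat w i (Disj a b) \<longleftrightarrow> sat w i a \<or> sat w i b"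
| "sat w i (Next a) \<longleftrightarrow> sat w (Suc i) a"
| "sat w i (Until a b) \<longleftrightarrow> (\<exists>k\<ge>i. sat w k b \<and> (\<forall>j. i \<le> j \<and> j < k \<longrightarrow> sat w j a))"

definition words :: "'p set \<Rightarrow> 'p ltl \<Rightarrow> (nat \<Rightarrow> 'p set) set" where
  "words P a = {w. (\<forall>i. w i \<subseteq> P) \<and> sat w 0 a}"


section \<open>Games\<close>

record ('v, 'p) game_graph =
  states0 :: "'v set"
  states1 :: "'v set"
  edges :: "('v \<times> 'v) set"
  props :: "'p set"
  label :: "'v \<Rightarrow> 'p set"

definition states :: "('v, 'p) game_graph \<Rightarrow> 'v set" where
  "states G = states0 G \<union> states1 G"

definition game_graph :: "('v, 'p) game_graph \<Rightarrow> bool" where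
  "game_graph G \<longleftrightarrow>
     finite (states G) \<and> states0 G \<inter> states1 G = {} \<and>
     edges G \<subseteq> states G \<times> states G \<and>
     (\<forall>v\<in>states G. \<exists>v'. (v, v') \<in> edges G) \<and>
     finite (props G) \<and> (\<forall>v\<in>states G. label G v \<subseteq> props G)"

definition ltl_game :: "('v, 'p) game_graph \<Rightarrow> 'p ltl \<Rightarrow> bool" where
  "ltl_game G a \<longleftrightarrow> game_graph G \<and> atoms a \<subseteq> props G"

definition play :: "('v, 'p) game_graph \<Rightarrow> (nat \<Rightarrow> 'v) \<Rightarrow> bool" where
  "play G r \<longleftrightarrow> (\<forall>i. (r i, r (Suc i)) \<in> edges G)"

text \<open>
  A partial function from histories and player-0 states; the history does not contain the current
  state.
\<close>

type_synonym 'v strategy = "'v list \<Rightarrow> 'v \<Rightarrow> 'v option"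

definition strategy :: "('v, 'p) game_graph \<Rightarrow> 'v strategy \<Rightarrow> bool" where
  "strategy G f \<longleftrightarrow>
     (\<forall>h v v'. f h v = Some v' \<longrightarrow>
        h \<in> lists (states G) \<and> v \<in> states0 G \<and> (v, v') \<in> edges G)"

definition follows :: "('v, 'p) game_graph \<Rightarrow> 'v strategy \<Rightarrow> (nat \<Rightarrow> 'v) \<Rightarrow> bool" where
  "follows G f r \<longleftrightarrow>
     (\<forall>i. r i \<in> states0 G \<longrightarrow> f (map r [0..<i]) (r i) = Some (r (Suc i)))"

text \<open>
  \<open>reached G f v h u\<close>: starting in \<open>v\<close> and following \<open>f\<close>, the play can be in state \<open>u\<close> after the
  history \<open>h\<close>.
\<close>

inductive reached :: "('v, 'p) game_graph \<Rightarrow> 'v strategy \<Rightarrow> 'v \<Rightarrow> 'v list \<Rightarrow> 'v \<Rightarrow> bool"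
  for G f v where
  start: "reached G f v [] v"
| move0: "reached G f v h u \<Longrightarrow> u \<in> states0 G \<Longrightarrow> f h u = Some u' \<Longrightarrow> reached G f v (h @ [u]) u'"
| move1: "reached G f v h u \<Longrightarrow> u \<in> states1 G \<Longrightarrow> (u, u') \<in> edges G \<Longrightarrow> reached G f v (h @ [u]) u'"

definition winning_from :: "('v, 'p) game_graph \<Rightarrow> 'p ltl \<Rightarrow> 'v strategy \<Rightarrow> 'v \<Rightarrow> bool" where
  "winning_from G a f v \<longleftrightarrow>
     (\<forall>h u. reached G f v h u \<and> u \<in> states0 G \<longrightarrow> f h u \<noteq> None) \<and>
     (\<forall>r. play G r \<and> r 0 = v \<and> follows G f r \<longrightarrow> (\<lambda>i. label G (r i)) \<in> words (props G) a)"

definition winning_region :: "('v, 'p) game_graph \<Rightarrow> 'p ltl \<Rightarrow> 'v set" where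
  "winning_region G a = {v \<in> states G. \<exists>f. strategy G f \<and> winning_from G a f v}"

text \<open>
  The states whose label satisfies a formula without temporal operators; the truth of such a
  formula depends on the letter at time 0 only.
\<close>

definition label_region :: "('v, 'p) game_graph \<Rightarrow> 'p ltl \<Rightarrow> 'v set" where
  "label_region G a = {v \<in> states G. sat (\<lambda>_. label G v) 0 a}"

definition Pre :: "('v, 'p) game_graph \<Rightarrow> 'v set \<Rightarrow> 'v set" where
  "Pre G A =
     {v \<in> states0 G. \<exists>v'\<in>A. (v, v') \<in> edges G} \<union>
     {v \<in> states1 G. \<forall>v'\<in>states G. (v, v') \<in> edges G \<longrightarrow> v' \<in> A}"

definition nu :: "('v, 'p) game_graph \<Rightarrow> ('v set \<Rightarrow> 'v set) \<Rightarrow> 'v set" where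
  "nu G F = (\<Inter>i. (F ^^ i) (states G))"

definition mu :: "('v set \<Rightarrow> 'v set) \<Rightarrow> 'v set" where
  "mu F = (\<Union>i. (F ^^ i) {})"


section \<open>Mode-target games\<close>

text \<open>
  Modes are \<open>mode S i\<close> for \<open>1 \<le> i \<le> nmodes S\<close>; the targets of mode \<open>i\<close> are \<open>target S i j\<close> for
  \<open>1 \<le> j \<le> ntargets S i\<close>. Values outside these ranges are irrelevant.
\<close>

record 'p mode_target =
  nmodes :: nat
  mode :: "nat \<Rightarrow> 'p"
  ntargets :: "nat \<Rightarrow> nat"
  target :: "nat \<Rightarrow> nat \<Rightarrow> 'p"

definition mt_formula :: "'p mode_target \<Rightarrow> 'p ltl" where
  "mt_formula S =
     Conjs (map (\<lambda>i. Impl (Eventually (Always (Atom (mode S i))))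
                          (Disjs (map (\<lambda>j. Eventually (Always (Atom (target S i j))))
                                      [1..<Suc (ntargets S i)])))
                [1..<Suc (nmodes S)])"

definition mt_game :: "('v, 'p) game_graph \<Rightarrow> 'p mode_target \<Rightarrow> bool" where
  "mt_game G S \<longleftrightarrow>
     ltl_game G (mt_formula S) \<and>
     props G = mode S ` {1..nmodes S} \<union> (\<Union>i\<in>{1..nmodes S}. target S i ` {1..ntargets S i}) \<and>
     (\<forall>v\<in>states G. \<forall>i\<in>{1..nmodes S}. \<forall>j\<in>{1..nmodes S}.
        j \<noteq> i \<longrightarrow> mode S i \<in> label G v \<longrightarrow> mode S j \<notin> label G v)"

text \<open>The 0 only matters when there are no modes.\<close>

definition max_targets :: "'p mode_target \<Rightarrow> nat" where
  "max_targets S = Max (insert 0 (ntargets S ` {1..nmodes S}))"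

definition target_bar :: "'p mode_target \<Rightarrow> nat \<Rightarrow> nat \<Rightarrow> 'p ltl" where
  "target_bar S i j = (if j \<le> ntargets S i then Atom (target S i j) else FF)"

definition mode_target_region :: "('v, 'p) game_graph \<Rightarrow> 'p mode_target \<Rightarrow> nat \<Rightarrow> 'v set" where
  "mode_target_region G S j =
     (\<Union>l\<in>{1..nmodes S}. label_region G (Conj (Atom (mode S l)) (target_bar S l j)))"

definition gr1_fixpoint :: "('v, 'p) game_graph \<Rightarrow> 'p mode_target \<Rightarrow> 'v set" where
  "gr1_fixpoint G S =
     nu G (\<lambda>Z. \<Inter>i\<in>{1..nmodes S}. mu (\<lambda>Y. \<Union>j\<in>{1..max_targets S}. nu G (\<lambda>X.
       (Pre G X \<inter> mode_target_region G S j) \<union>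
       Pre G Y \<union>
       (label_region G (Neg (Atom (mode S i))) \<inter> Pre G Z))))"


section \<open>Iterative evaluation of the fixed-point expression\<close>

text \<open>
  Programs map a state to a result and a new state, or to \<open>None\<close> if they do not terminate. The
  state counts the evaluations of \<open>Pre\<close> and holds previously computed values of the innermost fixed
  point. The programs use the edges of the game graph only through \<open>call_pre\<close>.
\<close>

record 'v eval_state =
  pre_calls :: nat
  stored :: "nat \<Rightarrow> nat \<Rightarrow> nat \<Rightarrow> 'v set"

type_synonym 'v program = "'v eval_state \<Rightarrow> ('v set \<times> 'v eval_state) option"

definition call_pre :: "('v, 'p) game_graph \<Rightarrow> 'v set \<Rightarrow> 'v program" where
  "call_pre G A s = Some (Pre G A, s\<lparr>pre_calls := Suc (pre_calls s)\<rparr>)"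

text \<open>
  Iterates \<open>F\<close> until the set no longer changes. The first argument of \<open>F\<close> is the number of the
  iteration.
\<close>

partial_function (option) iterate ::
  "(nat \<Rightarrow> 'v set \<Rightarrow> 'v program) \<Rightarrow> nat \<Rightarrow> 'v set \<Rightarrow> 'v program" where
  "iterate F k A s = do {
     (B, s') \<leftarrow> F k A s;
     if B = A then Some (B, s') else iterate F (Suc k) B s'
   }"

primrec union_over :: "(nat \<Rightarrow> 'v program) \<Rightarrow> nat list \<Rightarrow> 'v program" where
  "union_over F [] s = Some ({}, s)"
| "union_over F (j # js) s = do {
     (A, s') \<leftarrow> F j s;
     (B, s'') \<leftarrow> union_over F js s';
     Some (A \<union> B, s'')
   }"

primrec inter_over :: "'v set \<Rightarrow> (nat \<Rightarrow> 'v program) \<Rightarrow> nat list \<Rightarrow> 'v program" where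
  "inter_over V F [] s = Some (V, s)"
| "inter_over V F (i # is) s = do {
     (A, s') \<leftarrow> F i s;
     (B, s'') \<leftarrow> inter_over V F is s';
     Some (A \<inter> B, s'')
   }"

definition eval_body ::
  "('v, 'p) game_graph \<Rightarrow> 'p mode_target \<Rightarrow> nat \<Rightarrow> nat \<Rightarrow> 'v set \<Rightarrow> 'v set \<Rightarrow> 'v set \<Rightarrow> 'v program" where
  "eval_body G S i j Z Y X s = do {
     (PX, s1) \<leftarrow> call_pre G X s;
     (PY, s2) \<leftarrow> call_pre G Y s1;
     (PZ, s3) \<leftarrow> call_pre G Z s2;
     Some ((PX \<inter> mode_target_region G S j) \<union> PY \<union>
           (label_region G (Neg (Atom (mode S i))) \<inter> PZ), s3)
   }"

text \<open>
  The value of the innermost fixed point for mode \<open>i\<close>, the \<open>k\<close>-th iteration of \<open>Y\<close> and index \<open>j\<close> is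
  stored, and initializes the same computation in the next iteration of \<open>Z\<close>. This is permitted
  because the iterates of \<open>Z\<close> decrease, and with them, for fixed \<open>i\<close>, \<open>k\<close> and \<open>j\<close>, that value.
\<close>

definition eval_X ::
  "('v, 'p) game_graph \<Rightarrow> 'p mode_target \<Rightarrow> nat \<Rightarrow> nat \<Rightarrow> nat \<Rightarrow> 'v set \<Rightarrow> 'v set \<Rightarrow> 'v program" where
  "eval_X G S i k j Z Y s = do {
     (X, s') \<leftarrow> iterate (\<lambda>_. eval_body G S i j Z Y) 0 (stored s i k j) s;
     Some (X, s'\<lparr>stored := (stored s')(i := (stored s' i)(k := (stored s' i k)(j := X)))\<rparr>)
   }"

definition eval_Y :: "('v, 'p) game_graph \<Rightarrow> 'p mode_target \<Rightarrow> nat \<Rightarrow> 'v set \<Rightarrow> 'v program" where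
  "eval_Y G S i Z =
     iterate (\<lambda>k Y. union_over (\<lambda>j. eval_X G S i k j Z Y) [1..<Suc (max_targets S)]) 0 {}"

definition eval_Z :: "('v, 'p) game_graph \<Rightarrow> 'p mode_target \<Rightarrow> 'v program" where
  "eval_Z G S =
     iterate (\<lambda>_ Z. inter_over (states G) (\<lambda>i. eval_Y G S i Z) [1..<Suc (nmodes S)]) 0 (states G)"

definition GR1_Emb ::
  "('v, 'p) game_graph \<Rightarrow> 'p mode_target \<Rightarrow> ('v set \<times> 'v eval_state) option" where
  "GR1_Emb G S = eval_Z G S \<lparr>pre_calls = 0, stored = (\<lambda>_ _ _. states G)\<rparr>"

end

theory Submission imports Defs begin

text \<open>
  Since the modes exclude each other, a play satisfies the mode-target formula iff it eventually
  stays in a single region \<open>\<Union>\<^sub>l \<lbrakk>M\<^sub>l \<and> T\<^sub>l\<^sub>,\<^sub>j\<rbrakk>\<close> or leaves every mode infinitely often: switching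
  between modes forever inside such a region also leaves every mode infinitely often. This is a GR(1)
  objective. On the fixed point, player 0 pursues the guarantees \<open>\<not> M\<^sub>i\<close> cyclically, never
  increasing the rank of the current state in the approximations of \<open>Y\<close>. Conversely, if a winning
  state were lost by one unfolding of the fixed point for some \<open>i\<close>, player 1 could stay in \<open>M\<^sub>i\<close>
  forever while leaving all the regions infinitely often, cyclically in \<open>j\<close>.

  For the cost, the stored values only shrink, so over the whole evaluation there are at most \<open>n\<close>
  shrinking iterations of \<open>X\<close> for each of the \<open>m (n + 1) max t\<^sub>i\<close> triples \<open>(i, k, j)\<close>; in addition each of the
  at most \<open>m (n + 1)\<^sup>2 max t\<^sub>i\<close> evaluations of \<open>X\<close> has one iteration that detects stability.
\<close>

section \<open>Fixed points over finite sets\<close>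

lemma funpow_decreasing:
  fixes F :: "'a set \<Rightarrow> 'a set"
  assumes "mono F" "F A \<subseteq> A"
  shows "(F ^^ Suc k) A \<subseteq> (F ^^ k) A"
  by (induction k) (use assms in \<open>auto dest: monoD\<close>)

lemma funpow_increasing:
  fixes F :: "'a set \<Rightarrow> 'a set"
  assumes "mono F"
  shows "(F ^^ k) {} \<subseteq> (F ^^ Suc k) {}"
  by (induction k) (use assms in \<open>auto dest: monoD\<close>)

lemma gfp_le_funpow:
  fixes F :: "'a set \<Rightarrow> 'a set"
  assumes "mono F" "gfp F \<subseteq> A"
  shows "gfp F \<subseteq> (F ^^ k) A"
proof (induction k)
  case (Suc k)
  then have "F (gfp F) \<subseteq> F ((F ^^ k) A)"
    using assms(1) by (rule monoD[rotated])
  then show ?case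
    using gfp_unfold[OF assms(1)] by simp
qed (use assms in simp)

lemma funpow_le_lfp:
  fixes F :: "'a set \<Rightarrow> 'a set"
  assumes "mono F"
  shows "(F ^^ k) {} \<subseteq> lfp F"
proof (induction k)
  case (Suc k)
  then have "F ((F ^^ k) {}) \<subseteq> F (lfp F)"
    using assms(1) by (rule monoD[rotated])
  then show ?case
    using lfp_unfold[OF assms(1)] by simp
qed simp

text \<open>The start \<open>A\<close> may be any pre-fixed point above \<open>gfp F\<close>, so
  that a computation can resume from a stored value. Each of the \<open>N\<close> changing steps
  removes an element, hence the drop in cardinality pays for \<open>N\<close>.\<close>

lemma decreasing_iteration:
  fixes F :: "'a set \<Rightarrow> 'a set"
  assumes mono: "mono F" and fin: "finite A" and dec: "F A \<subseteq> A" and le: "gfp F \<subseteq> A"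
  obtains N where "(F ^^ N) A = gfp F" "\<And>k. k < N \<Longrightarrow> (F ^^ Suc k) A \<noteq> (F ^^ k) A"
    "N + card (gfp F) \<le> card A"
proof -
  have sub: "(F ^^ k) A \<subseteq> A" for k
    by (induction k) (use funpow_decreasing[OF mono dec] in \<open>auto dest: subsetD\<close>)
  have count: "n + card ((F ^^ n) A) \<le> card A" if "\<And>k. k < n \<Longrightarrow> (F ^^ Suc k) A \<noteq> (F ^^ k) A" for n
    using that
  proof (induction n)
    case (Suc n)
    have "(F ^^ Suc n) A \<subset> (F ^^ n) A"
      using funpow_decreasing[OF mono dec, of n] Suc.prems[of n] by blast
    then have "card ((F ^^ Suc n) A) < card ((F ^^ n) A)"
      using psubset_card_mono finite_subset[OF sub fin] by blast
    then show ?case using Suc by force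
  qed simp
  have ex: "\<exists>k. (F ^^ Suc k) A = (F ^^ k) A"
    using count[of "Suc (card A)"] by force
  define N where "N = (LEAST k. (F ^^ Suc k) A = (F ^^ k) A)"
  have N: "(F ^^ Suc N) A = (F ^^ N) A" unfolding N_def by (rule LeastI_ex[OF ex])
  have ne: "(F ^^ Suc k) A \<noteq> (F ^^ k) A" if "k < N" for k
    using not_less_Least[of k] that unfolding N_def by blast
  have "(F ^^ N) A \<subseteq> gfp F" by (rule gfp_upperbound) (use N in simp)
  then have "(F ^^ N) A = gfp F" using gfp_le_funpow[OF mono le, of N] by blast
  then show thesis using that[of N] ne count[of N] by simp
qed

lemma increasing_iteration:
  fixes F :: "'a set \<Rightarrow> 'a set"
  assumes mono: "mono F" and fin: "finite (lfp F)"
  obtains N where "(F ^^ N) {} = lfp F" "\<And>k. k < N \<Longrightarrow> (F ^^ Suc k) {} \<noteq> (F ^^ k) {}"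
    "N \<le> card (lfp F)"
proof -
  have count: "n \<le> card ((F ^^ n) {})" if "\<And>k. k < n \<Longrightarrow> (F ^^ Suc k) {} \<noteq> (F ^^ k) {}" for n
    using that
  proof (induction n)
    case (Suc n)
    have "(F ^^ n) {} \<subset> (F ^^ Suc n) {}"
      using funpow_increasing[OF mono, of n] Suc.prems[of n] by blast
    then have "card ((F ^^ n) {}) < card ((F ^^ Suc n) {})"
      using psubset_card_mono finite_subset[OF funpow_le_lfp[OF mono] fin] by blast
    then show ?case using Suc by force
  qed simp
  have bound: "card ((F ^^ n) {}) \<le> card (lfp F)" for n
    by (rule card_mono[OF fin funpow_le_lfp[OF mono]])
  have ex: "\<exists>k. (F ^^ Suc k) {} = (F ^^ k) {}"
    using count[of "Suc (card (lfp F))"] bound[of "Suc (card (lfp F))"] by force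
  define N where "N = (LEAST k. (F ^^ Suc k) {} = (F ^^ k) {})"
  have N: "(F ^^ Suc N) {} = (F ^^ N) {}" unfolding N_def by (rule LeastI_ex[OF ex])
  have ne: "(F ^^ Suc k) {} \<noteq> (F ^^ k) {}" if "k < N" for k
    using not_less_Least[of k] that unfolding N_def by blast
  have "lfp F \<subseteq> (F ^^ N) {}" by (rule lfp_lowerbound) (use N in simp)
  then have "(F ^^ N) {} = lfp F" using funpow_le_lfp[OF mono, of N] by blast
  then show thesis using that[of N] ne count[of N] bound[of N] by (meson order_trans)
qed

lemma nu_eq_gfp:
  assumes "mono F" "finite (states G)" "\<And>X. F X \<subseteq> states G"
  shows "nu G F = gfp F"
proof -
  have le: "gfp F \<subseteq> states G" using assms(3) gfp_unfold[OF assms(1)] by metis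
  obtain N where "(F ^^ N) (states G) = gfp F"
    using decreasing_iteration[OF assms(1,2) assms(3) le] by metis
  then show ?thesis using gfp_le_funpow[OF assms(1) le] unfolding nu_def by blast
qed

lemma mu_eq_lfp:
  assumes "mono F" "finite (lfp F)"
  shows "mu F = lfp F"
proof -
  obtain N where "(F ^^ N) {} = lfp F"
    using increasing_iteration[OF assms] by metis
  then show ?thesis using funpow_le_lfp[OF assms(1)] unfolding mu_def by blast
qed


section \<open>Strategies and plays\<close>

lemma Pre_mono: "A \<subseteq> B \<Longrightarrow> Pre G A \<subseteq> Pre G B"
  unfolding Pre_def by blast

lemma Pre_subset_states: "Pre G A \<subseteq> states G"
  unfolding Pre_def states_def by blast

lemma play_in_states:
  assumes "game_graph G" "play G r"
  shows "r n \<in> states G"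
  using assms unfolding game_graph_def play_def by blast

text \<open>Player 0 carries a memory \<open>c\<close>, recomputed from the history by folding
  \<open>upd\<close>. While \<open>Inv\<close> holds, the next state can be forced into
  \<open>D c u\<close>, which in turn preserves \<open>Inv\<close>.\<close>

lemma memory_strategy:
  fixes D :: "'m \<Rightarrow> 'v \<Rightarrow> 'v set"
  assumes G: "game_graph G" and init: "Inv c0 v"
    and pre: "\<And>c u. Inv c u \<Longrightarrow> u \<in> Pre G (D c u)"
    and inv: "\<And>c u u'. Inv c u \<Longrightarrow> u' \<in> D c u \<Longrightarrow> Inv (upd c u) u'"
  obtains f where "strategy G f"
    and "\<And>h u. reached G f v h u \<Longrightarrow> u \<in> states0 G \<Longrightarrow> f h u \<noteq> None"
    and "\<And>r. play G r \<Longrightarrow> r 0 = v \<Longrightarrow> follows G f r \<Longrightarrow>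
      \<exists>c. \<forall>n. c (Suc n) = upd (c n) (r n) \<and> Inv (c n) (r n) \<and> r (Suc n) \<in> D (c n) (r n)"
proof -
  define mem where "mem h = foldl upd c0 h" for h
  define good where "good h u u' \<longleftrightarrow> (u, u') \<in> edges G \<and> u' \<in> D (mem h) u" for h u u'
  define f where "f h u = (if h \<in> lists (states G) \<and> u \<in> states0 G \<and> (\<exists>u'. good h u u')
    then Some (SOME u'. good h u u') else None)" for h u
  have disj: "states0 G \<inter> states1 G = {}" and E: "edges G \<subseteq> states G \<times> states G"
    using G unfolding game_graph_def by auto
  have good: "good h u u'" "h \<in> lists (states G)" "u \<in> states0 G" if "f h u = Some u'" for h u u'
    using that someI_ex[of "good h u"] unfolding f_def by (auto split: if_splits)
  have "strategy G f" using good unfolding strategy_def good_def by blast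
  have D0: "\<exists>u'. good h u u'" if "Inv (mem h) u" "u \<in> states0 G" for h u
    using pre[OF that(1)] that(2) disj unfolding Pre_def good_def by blast
  have D1: "u' \<in> D (mem h) u" if "Inv (mem h) u" "u \<in> states1 G" "(u, u') \<in> edges G" for h u u'
    using pre[OF that(1)] that(2,3) disj E unfolding Pre_def by blast
  have mem_snoc: "mem (h @ [u]) = upd (mem h) u" for h u unfolding mem_def by simp
  have reach: "h \<in> lists (states G) \<and> Inv (mem h) u" if "reached G f v h u" for h u
    using that
  proof induction
    case start
    then show ?case using init by (simp add: mem_def)
  next
    case (move0 h u u')
    then show ?case using good(1)[of h u u'] inv[of "mem h" u u']
      unfolding good_def states_def by (auto simp: mem_snoc)
  next
    case (move1 h u u')
    then show ?case using D1[of h u u'] inv[of "mem h" u u']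
      unfolding states_def by (auto simp: mem_snoc)
  qed
  have defined: "f h u \<noteq> None" if "reached G f v h u" "u \<in> states0 G" for h u
    using D0[of h u] reach[OF that(1)] that(2) unfolding f_def by auto
  have run: "\<exists>c. \<forall>n. c (Suc n) = upd (c n) (r n) \<and> Inv (c n) (r n) \<and> r (Suc n) \<in> D (c n) (r n)"
    if "play G r" "r 0 = v" "follows G f r" for r
  proof -
    define c where "c n = mem (map r [0..<n])" for n
    have c_Suc: "c (Suc n) = upd (c n) (r n)" for n unfolding c_def by (simp add: mem_snoc)
    have mv: "r (Suc n) \<in> D (c n) (r n)" if I: "Inv (c n) (r n)" for n
    proof (cases "r n \<in> states0 G")
      case True
      then have "f (map r [0..<n]) (r n) = Some (r (Suc n))"
        using \<open>follows G f r\<close> unfolding follows_def by blast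
      then show ?thesis using good(1) unfolding good_def c_def by blast
    next
      case False
      have e: "(r n, r (Suc n)) \<in> edges G" using \<open>play G r\<close> unfolding play_def by blast
      then have "r n \<in> states1 G" using False E unfolding states_def by blast
      then show ?thesis using D1 I e unfolding c_def by blast
    qed
    have "Inv (c n) (r n)" for n
    proof (induction n)
      case 0
      then show ?case using init \<open>r 0 = v\<close> unfolding c_def mem_def by simp
    next
      case (Suc n)
      then show ?case using inv[OF Suc mv[OF Suc]] c_Suc by simp
    qed
    then show ?thesis using c_Suc mv by blast
  qed
  show thesis using that[OF \<open>strategy G f\<close> defined run] .
qed

text \<open>Dual of \<open>memory_strategy\<close> against a fixed \<open>f\<close>: outside
  \<open>Pre G (D c u)\<close>, a player-0 state has no successor in \<open>D c u\<close>, so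
  \<open>f\<close> cannot enter it, and a player-1 state has some successor outside.\<close>

lemma spoiling_play:
  fixes D :: "'m \<Rightarrow> 'v \<Rightarrow> 'v set"
  assumes G: "game_graph G" and f: "strategy G f" and init: "Inv c0 v"
    and defined: "\<And>h u. reached G f v h u \<Longrightarrow> u \<in> states0 G \<Longrightarrow> f h u \<noteq> None"
    and pre: "\<And>c u. Inv c u \<Longrightarrow> u \<in> states G - Pre G (D c u)"
    and inv: "\<And>c u u'. Inv c u \<Longrightarrow> u' \<in> states G - D c u \<Longrightarrow> Inv (upd c u) u'"
  obtains r c where "play G r" "r 0 = v" "follows G f r"
    and "\<And>n. reached G f v (map r [0..<n]) (r n)"
    and "\<And>n. c (Suc n) = upd (c n) (r n)" "\<And>n. Inv (c n) (r n)"
    and "\<And>n. r (Suc n) \<in> states G - D (c n) (r n)"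
proof -
  have E: "edges G \<subseteq> states G \<times> states G" and disj: "states0 G \<inter> states1 G = {}"
    using G unfolding game_graph_def by auto
  \<comment> \<open>Dependent choice runs over triples of history, state and memory; the history is
    carried because \<open>f\<close> and \<open>reached\<close> depend on it.\<close>
  define P where "P x \<longleftrightarrow> (case x of (h, u, c) \<Rightarrow> reached G f v h u \<and> Inv c u)" for x
  define Q where "Q x y \<longleftrightarrow> (case (x, y) of ((h, u, c), (h', u', c')) \<Rightarrow>
    h' = h @ [u] \<and> c' = upd c u \<and> (u, u') \<in> edges G \<and> u' \<in> states G - D c u \<and>
    (u \<in> states0 G \<longrightarrow> f h u = Some u'))" for x y
  have step: "\<exists>y. P y \<and> Q x y" if "P x" for x
  proof -
    obtain h u c where x: "x = (h, u, c)" by (cases x)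
    have R: "reached G f v h u" and I: "Inv c u" using that unfolding P_def x by auto
    have "\<exists>u'. reached G f v (h @ [u]) u' \<and> (u, u') \<in> edges G \<and> u' \<in> states G - D c u \<and>
      (u \<in> states0 G \<longrightarrow> f h u = Some u')"
    proof (cases "u \<in> states0 G")
      case True
      then obtain u' where u': "f h u = Some u'" using defined[OF R] by blast
      then have e: "(u, u') \<in> edges G" using f unfolding strategy_def by blast
      then have "u' \<in> states G - D c u"
        using pre[OF I] True E unfolding Pre_def by blast
      then show ?thesis using e u' reached.move0[OF R True u'] by blast
    next
      case False
      then have u1: "u \<in> states1 G" using pre[OF I] unfolding states_def by blast
      then obtain u' where "(u, u') \<in> edges G" "u' \<in> states G - D c u"
        using pre[OF I] unfolding Pre_def by blast
      then show ?thesis using False reached.move1[OF R u1] by blast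
    qed
    then obtain u' where "reached G f v (h @ [u]) u'" "Q x (h @ [u], u', upd c u)"
      unfolding Q_def x by auto
    moreover from this have "P (h @ [u], u', upd c u)"
      using inv[OF I, of u'] unfolding P_def Q_def x by auto
    ultimately show ?thesis by blast
  qed
  have "P ([], v, c0)" unfolding P_def using init reached.start by auto
  then obtain X where X0: "X 0 = ([], v, c0)" and X: "\<And>n. P (X n)" "\<And>n. Q (X n) (X (Suc n))"
    using dependent_nat_choice[of "\<lambda>n x. P x \<and> (n = 0 \<longrightarrow> x = ([], v, c0))" "\<lambda>_. Q"] step
    by (metis nat.distinct(1))
  define r where "r n = fst (snd (X n))" for n
  define c where "c n = snd (snd (X n))" for n
  have Q: "fst (X (Suc n)) = fst (X n) @ [r n]" "c (Suc n) = upd (c n) (r n)"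
    "(r n, r (Suc n)) \<in> edges G" "r (Suc n) \<in> states G - D (c n) (r n)"
    "r n \<in> states0 G \<Longrightarrow> f (fst (X n)) (r n) = Some (r (Suc n))" for n
    using X(2)[of n] unfolding Q_def r_def c_def by (auto simp: split_beta)
  have hist: "fst (X n) = map r [0..<n]" for n
    by (induction n) (use X0 Q(1) in auto)
  have P: "reached G f v (map r [0..<n]) (r n)" "Inv (c n) (r n)" for n
    using X(1)[of n] hist[of n] unfolding P_def r_def c_def by (auto simp: split_beta)
  show thesis
  proof (rule that[of r c])
    show "play G r" unfolding play_def using Q(3) by blast
    show "r 0 = v" unfolding r_def X0 by simp
    show "follows G f r" unfolding follows_def using Q(5) hist by auto
  qed (use P Q in auto)
qed

text \<open>
  Both players cycle through finitely many tasks by means of an unbounded counter, reduced modulo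
  the number of tasks.
\<close>

lemma counter_cycles:
  fixes c :: "nat \<Rightarrow> nat"
  assumes step: "\<And>n. c (Suc n) = (if adv n then Suc (c n) else c n)"
    and inf: "\<And>k. \<exists>n\<ge>k. adv n" and i: "i \<in> {1..m}"
  shows "\<exists>n\<ge>k. adv n \<and> Suc (c n mod m) = i"
proof -
  have mono: "c a \<le> c b" if "a \<le> b" for a b
    using that by (rule lift_Suc_mono_le[rotated]) (simp add: step)
  have unbounded: "\<exists>n. q < c n" for q
  proof (induction q)
    case 0
    then show ?case using inf[of 0] step by (metis zero_less_Suc)
  next
    case (Suc q)
    then obtain n where n: "q < c n" by blast
    obtain n' where "n' \<ge> n" "adv n'" using inf by blast
    then have "Suc q < c (Suc n')" using step[of n'] mono[of n n'] n by simp
    then show ?case by blast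
  qed
  \<comment> \<open>A value of the wanted residue that the counter has not passed at time
    \<open>k\<close>; \<open>c k \<le> c k * m\<close> because \<open>m\<close> is positive.\<close>
  define q where "q = c k * m + (i - 1)"
  have "c k \<le> c k * m" using i by simp
  then have "c k \<le> q" unfolding q_def by linarith
  moreover have "Suc (q mod m) = i" unfolding q_def using i by (auto simp del: add_diff_assoc)
  ultimately have q: "c k \<le> q" "Suc (q mod m) = i" by blast+
  \<comment> \<open>The counter grows by at most one, so the step at which it first exceeds
    \<open>q\<close> is an advance from exactly \<open>q\<close>.\<close>
  define l where "l = (LEAST n. q < c n)"
  have l: "q < c l" unfolding l_def by (rule LeastI_ex[OF unbounded])
  have "\<not> l \<le> k" using mono[of l k] l q by linarith
  then obtain n where n: "l = Suc n" "k \<le> n" by (cases l) auto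
  have "\<not> q < c n" using not_less_Least[of n "\<lambda>n. q < c n"] n unfolding l_def by simp
  then have "adv n" "c n = q" using l step[of n] n by (auto split: if_splits)
  then show ?thesis using n q by blast
qed


section \<open>The mode-target objective\<close>

lemma sat_Conjs: "sat w i (Conjs as) \<longleftrightarrow> (\<forall>a\<in>set as. sat w i a)"
  unfolding Conjs_def by (induction as) auto

lemma sat_Disjs: "sat w i (Disjs as) \<longleftrightarrow> (\<exists>a\<in>set as. sat w i a)"
  unfolding Disjs_def by (induction as) auto

lemma sat_mt_formula:
  "sat w 0 (mt_formula S) \<longleftrightarrow> (\<forall>i\<in>{1..nmodes S}. (\<exists>k. \<forall>l\<ge>k. mode S i \<in> w l) \<longrightarrow>
     (\<exists>j\<in>{1..ntargets S i}. \<exists>k. \<forall>l\<ge>k. target S i j \<in> w l))"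
  unfolding mt_formula_def by (simp add: sat_Conjs sat_Disjs atLeastLessThanSuc_atLeastAtMost del: upt_Suc) blast

text \<open>With modes but no targets, the union over \<open>j\<close> and hence the fixed point
  would be empty, although player 0 might still win by leaving every mode infinitely often. The
  second assumption excludes this.\<close>

locale mode_target_game =
  fixes G :: "('v, 'p) game_graph" and S :: "'p mode_target"
  assumes mt_game: "mt_game G S" and targets: "nmodes S > 0 \<Longrightarrow> max_targets S > 0"
begin

abbreviation "V \<equiv> states G"
abbreviation "m \<equiv> nmodes S"
abbreviation "t \<equiv> max_targets S"
abbreviation "R j \<equiv> mode_target_region G S j"
abbreviation "N i \<equiv> label_region G (Neg (Atom (mode S i)))"
abbreviation "W \<equiv> winning_region G (mt_formula S)"

text \<open>
  The generalized reactivity(1) objective, in contrapositive form: the assumptions are \<open>\<box>\<diamond>\<not>R j\<close> and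
  the guarantees \<open>\<box>\<diamond>N i\<close>.
\<close>

definition gr1 :: "(nat \<Rightarrow> 'v) \<Rightarrow> bool" where
  "gr1 r \<longleftrightarrow> (\<exists>j\<in>{1..t}. \<exists>k. \<forall>l\<ge>k. r l \<in> R j) \<or> (\<forall>i\<in>{1..m}. \<forall>k. \<exists>l\<ge>k. r l \<in> N i)"

definition op_X :: "nat \<Rightarrow> nat \<Rightarrow> 'v set \<Rightarrow> 'v set \<Rightarrow> 'v set \<Rightarrow> 'v set" where
  "op_X i j Z Y X = (Pre G X \<inter> R j) \<union> Pre G Y \<union> (N i \<inter> Pre G Z)"

definition op_Y :: "nat \<Rightarrow> 'v set \<Rightarrow> 'v set \<Rightarrow> 'v set" where
  "op_Y i Z Y = (\<Union>j\<in>{1..t}. gfp (op_X i j Z Y))"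

text \<open>Intersecting with \<open>V\<close> keeps the operator inside the states even without
  modes, where the indexed intersection is \<open>UNIV\<close>.\<close>

definition op_Z :: "'v set \<Rightarrow> 'v set" where
  "op_Z Z = V \<inter> (\<Inter>i\<in>{1..m}. lfp (op_Y i Z))"

lemma graph: "game_graph G"
  using mt_game unfolding mt_game_def ltl_game_def by blast

lemma fin: "finite V"
  using graph unfolding game_graph_def by blast

lemma R_iff: "v \<in> R j \<longleftrightarrow> v \<in> V \<and> (\<exists>i\<in>{1..m}. mode S i \<in> label G v \<and> j \<le> ntargets S i \<and>
    target S i j \<in> label G v)"
  unfolding mode_target_region_def label_region_def target_bar_def by auto

lemma N_iff: "v \<in> N i \<longleftrightarrow> v \<in> V \<and> mode S i \<notin> label G v"
  unfolding label_region_def by auto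

lemma ntargets_le: "i \<in> {1..m} \<Longrightarrow> ntargets S i \<le> t"
  unfolding max_targets_def by (intro Max_ge) auto

lemma exclusive:
  "v \<in> V \<Longrightarrow> i \<in> {1..m} \<Longrightarrow> j \<in> {1..m} \<Longrightarrow> mode S i \<in> label G v \<Longrightarrow> mode S j \<in> label G v \<Longrightarrow> i = j"
  using mt_game unfolding mt_game_def by metis

lemma sat_iff_gr1:
  assumes r: "\<And>n. r n \<in> V"
  shows "sat (\<lambda>n. label G (r n)) 0 (mt_formula S) \<longleftrightarrow> gr1 r"
proof
  assume sat: "sat (\<lambda>n. label G (r n)) 0 (mt_formula S)"
  show "gr1 r"
  proof (cases "\<forall>i\<in>{1..m}. \<forall>k. \<exists>l\<ge>k. r l \<in> N i")
    case False
    then obtain i k where i: "i \<in> {1..m}" and k: "\<forall>l\<ge>k. mode S i \<in> label G (r l)"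
      using r by (auto simp: N_iff)
    then obtain j k' where j: "j \<in> {1..ntargets S i}" and k': "\<forall>l\<ge>k'. target S i j \<in> label G (r l)"
      using sat unfolding sat_mt_formula by blast
    have "\<forall>l\<ge>max k k'. r l \<in> R j" using i j k k' r by (auto simp: R_iff)
    moreover have "j \<in> {1..t}" using j ntargets_le[OF i] by auto
    ultimately show ?thesis unfolding gr1_def by blast
  qed (auto simp: gr1_def)
next
  assume "gr1 r"
  then consider j k where "j \<in> {1..t}" "\<forall>l\<ge>k. r l \<in> R j"
    | "\<forall>i\<in>{1..m}. \<forall>k. \<exists>l\<ge>k. r l \<in> N i" unfolding gr1_def by blast
  then show "sat (\<lambda>n. label G (r n)) 0 (mt_formula S)"
  proof cases
    case 1
    show ?thesis unfolding sat_mt_formula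
    proof (intro ballI impI)
      fix i assume i: "i \<in> {1..m}" and "\<exists>k. \<forall>l\<ge>k. mode S i \<in> label G (r l)"
      then obtain k' where k': "\<forall>l\<ge>k'. mode S i \<in> label G (r l)" by blast
      have *: "j \<le> ntargets S i \<and> target S i j \<in> label G (r l)" if "l \<ge> max k k'" for l
      proof -
        have "r l \<in> R j" using 1 that by simp
        then obtain i' where "i' \<in> {1..m}" "mode S i' \<in> label G (r l)" "j \<le> ntargets S i'"
          "target S i' j \<in> label G (r l)" unfolding R_iff by blast
        \<comment> \<open>The mode witnessing \<open>R j\<close> must be the one in which the play
          stays, so the target belongs to mode \<open>i\<close> itself.\<close>
        moreover from this have "i' = i" using exclusive[OF r] i k' that by simp
        ultimately show ?thesis by simp
      qed
      then have "j \<in> {1..ntargets S i}" using 1(1) *[of "max k k'"] by auto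
      then show "\<exists>j\<in>{1..ntargets S i}. \<exists>k. \<forall>l\<ge>k. target S i j \<in> label G (r l)" using * by blast
    qed
  next
    case 2
    then show ?thesis unfolding sat_mt_formula by (meson N_iff)
  qed
qed

lemma winning_from_iff:
  "winning_from G (mt_formula S) f v \<longleftrightarrow>
     (\<forall>h u. reached G f v h u \<and> u \<in> states0 G \<longrightarrow> f h u \<noteq> None) \<and>
     (\<forall>r. play G r \<and> r 0 = v \<and> follows G f r \<longrightarrow> gr1 r)"
proof -
  have "(\<lambda>i. label G (r i)) \<in> words (props G) (mt_formula S) \<longleftrightarrow> gr1 r" if "play G r" for r
    using play_in_states[OF graph that] sat_iff_gr1[of r] graph
    unfolding words_def game_graph_def by auto
  then show ?thesis unfolding winning_from_def by blast
qed

section \<open>The operators of the expression and their nested fixed points\<close>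

lemma op_X_mono:
  "Z \<subseteq> Z' \<Longrightarrow> Y \<subseteq> Y' \<Longrightarrow> X \<subseteq> X' \<Longrightarrow> op_X i j Z Y X \<subseteq> op_X i j Z' Y' X'"
  unfolding op_X_def using Pre_mono[of Z Z' G] Pre_mono[of Y Y' G] Pre_mono[of X X' G] by blast

lemma mono_op_X: "mono (op_X i j Z Y)"
  by (intro monoI op_X_mono) auto

lemma op_X_subset: "op_X i j Z Y X \<subseteq> V"
  unfolding op_X_def using Pre_subset_states[of G] by (auto simp: N_iff)

lemma gfp_op_X_mono: "Z \<subseteq> Z' \<Longrightarrow> Y \<subseteq> Y' \<Longrightarrow> gfp (op_X i j Z Y) \<subseteq> gfp (op_X i j Z' Y')"
  by (intro gfp_mono op_X_mono) auto

lemma gfp_op_X_subset: "gfp (op_X i j Z Y) \<subseteq> V"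
  using op_X_subset gfp_unfold[OF mono_op_X] by metis

lemma nu_op_X: "nu G (op_X i j Z Y) = gfp (op_X i j Z Y)"
  by (rule nu_eq_gfp[OF mono_op_X fin op_X_subset])

lemma op_Y_mono: "Z \<subseteq> Z' \<Longrightarrow> Y \<subseteq> Y' \<Longrightarrow> op_Y i Z Y \<subseteq> op_Y i Z' Y'"
  unfolding op_Y_def by (intro UN_mono gfp_op_X_mono) auto

lemma mono_op_Y: "mono (op_Y i Z)"
  by (intro monoI op_Y_mono) auto

lemma op_Y_subset: "op_Y i Z Y \<subseteq> V"
  unfolding op_Y_def using gfp_op_X_subset by blast

lemma lfp_op_Y_subset: "lfp (op_Y i Z) \<subseteq> V"
  using op_Y_subset lfp_unfold[OF mono_op_Y] by metis

lemma mu_op_Y: "mu (op_Y i Z) = lfp (op_Y i Z)"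
  by (rule mu_eq_lfp[OF mono_op_Y finite_subset[OF lfp_op_Y_subset fin]])

lemma mono_op_Z: "mono op_Z"
  unfolding op_Z_def by (intro monoI Int_mono INT_anti_mono order_refl lfp_mono op_Y_mono) auto

lemma op_Z_subset: "op_Z Z \<subseteq> V"
  unfolding op_Z_def by blast

lemma gr1_fixpoint_eq: "gr1_fixpoint G S = gfp op_Z"
proof -
  have "gr1_fixpoint G S = nu G (\<lambda>Z. \<Inter>i\<in>{1..m}. lfp (op_Y i Z))"
    unfolding gr1_fixpoint_def op_X_def[symmetric] nu_op_X op_Y_def[symmetric] mu_op_Y ..
  also have "\<dots> = nu G op_Z"
  proof (cases "m = 0")
    \<comment> \<open>Without modes every later iterate of the original body is \<open>UNIV\<close>;
      only the zeroth iterate cuts the intersection down to \<open>V\<close>.\<close>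
    case True
    have "((\<lambda>_. UNIV) ^^ k) V = (if k = 0 then V else UNIV)" "((\<lambda>_. V) ^^ k) V = V" for k
      by (cases k; simp)+
    then show ?thesis unfolding nu_def op_Z_def True by auto
  next
    case False
    then have "1 \<in> {1..m}" by simp
    then have "(\<Inter>i\<in>{1..m}. lfp (op_Y i Z)) \<subseteq> V" for Z using lfp_op_Y_subset by blast
    then have "(\<lambda>Z. \<Inter>i\<in>{1..m}. lfp (op_Y i Z)) = op_Z" unfolding op_Z_def by blast
    then show ?thesis by simp
  qed
  also have "\<dots> = gfp op_Z" by (rule nu_eq_gfp[OF mono_op_Z fin op_Z_subset])
  finally show ?thesis .
qed


section \<open>The fixed point is winning\<close>

text \<open>The memory counts the guarantees met so far and thereby selects the current
  \<open>i = idx c\<close>. Until the next one is met, the pair \<open>(rk, jx)\<close> never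
  increases lexicographically; if none is met any more, the pair becomes constant, which confines
  the play to one \<open>R j\<close>.\<close>

lemma fixpoint_winning:
  assumes v: "v \<in> gfp op_Z"
  shows "v \<in> W"
proof -
  define Z where "Z = gfp op_Z"
  have vV: "v \<in> V" using v op_Z_subset gfp_unfold[OF mono_op_Z] by blast
  show ?thesis
  proof (cases "m = 0")
    case True
    have "\<And>u. u \<in> V \<Longrightarrow> u \<in> Pre G V"
      using graph unfolding game_graph_def Pre_def states_def by blast
    then obtain f where "strategy G f"
      "\<And>h u. reached G f v h u \<Longrightarrow> u \<in> states0 G \<Longrightarrow> f h u \<noteq> None"
      using memory_strategy[OF graph, where Inv = "\<lambda>(_::unit) u. u \<in> V" and D = "\<lambda>_ _. V"
          and upd = "\<lambda>_ _. ()" and ?c0.0 = "()" and v = v] vV by metis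
    moreover have "gr1 r" for r using True by (simp add: gr1_def)
    ultimately show ?thesis unfolding winning_region_def winning_from_iff using vV by blast
  next
    case False
    define idx where "idx c = Suc (c mod m)" for c
    have idx: "idx c \<in> {1..m}" for c
      unfolding idx_def using False by (simp add: Suc_leI)
    define Yi where "Yi i k = (op_Y i Z ^^ k) {}" for i k
    define Xi where "Xi i k j = gfp (op_X i j Z (Yi i k))" for i k j
    have Yi_Suc: "Yi i (Suc k) = (\<Union>j\<in>{1..t}. Xi i k j)" for i k
      unfolding Yi_def Xi_def by (simp add: op_Y_def)
    have Xi_unfold: "Xi i k j = op_X i j Z (Yi i k) (Xi i k j)" for i k j
      unfolding Xi_def by (rule gfp_unfold[OF mono_op_X])
    define Q where "Q i = (\<Union>k. Yi i (Suc k))" for i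
    have Yi_le: "Yi i k \<subseteq> Yi i (Suc k)" for i k
      unfolding Yi_def by (rule funpow_increasing[OF mono_op_Y])
    have Q_lfp: "Q i = lfp (op_Y i Z)" for i
    proof -
      have "lfp (op_Y i Z) = (\<Union>k. Yi i k)" unfolding mu_op_Y[symmetric] mu_def Yi_def ..
      moreover have "(\<Union>k. Yi i k) \<subseteq> Q i"
        unfolding Q_def by (rule UN_mono[OF order_refl Yi_le])
      ultimately show ?thesis unfolding Q_def by blast
    qed
    have "Z \<subseteq> op_Z Z" unfolding Z_def using gfp_unfold[OF mono_op_Z] by (rule equalityD1)
    then have Z_Q: "Z \<subseteq> Q i" if "i \<in> {1..m}" for i
      using that unfolding Q_lfp op_Z_def by blast
    \<comment> \<open>The shifted index makes \<open>Yi i (rk i u)\<close> the stage just before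
      \<open>u\<close> enters, which is the \<open>Y\<close> in the unfolding of
      \<open>Xi\<close>.\<close>
    define rk where "rk i u = (LEAST k. u \<in> Yi i (Suc k))" for i u
    have rk: "u \<in> Yi i (Suc (rk i u))" if "u \<in> Q i" for i u
      using that LeastI_ex[of "\<lambda>k. u \<in> Yi i (Suc k)"] unfolding rk_def Q_def by blast
    have rk_le: "rk i u \<le> k" if "u \<in> Yi i (Suc k)" for i u k
      using that unfolding rk_def by (rule Least_le)
    \<comment> \<open>The least index cannot grow: a successor of equal rank inside the same
      \<open>Xi\<close> has that index available too.\<close>
    define jx where "jx i u = (LEAST j. j \<in> {1..t} \<and> u \<in> Xi i (rk i u) j)" for i u
    have jx: "jx i u \<in> {1..t} \<and> u \<in> Xi i (rk i u) (jx i u)" if "u \<in> Q i" for i u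
      unfolding jx_def by (rule LeastI_ex) (use rk[OF that] in \<open>auto simp: Yi_Suc\<close>)
    have jx_le: "jx i u \<le> j" if "j \<in> {1..t}" "u \<in> Xi i (rk i u) j" for i u j
      using that unfolding jx_def by (intro Least_le) auto
    define adv where "adv c u \<longleftrightarrow> u \<in> N (idx c) \<inter> Pre G Z" for c u
    \<comment> \<open>The disjuncts of \<open>op_X\<close> in order of preference: complete the
      guarantee, lower the rank, or remain in the current \<open>X\<close>, which under
      \<open>Inv\<close> happens only inside \<open>R\<close>.\<close>
    define D where "D c u = (let i = idx c in
      if adv c u then Z else if u \<in> Pre G (Yi i (rk i u)) then Yi i (rk i u)
      else Xi i (rk i u) (jx i u))" for c u
    define upd where "upd c u = (if adv c u then Suc c else c)" for c u
    define Inv where "Inv c u \<longleftrightarrow> u \<in> Q (idx c)" for c u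
    have cases: "u \<in> R (jx (idx c) u) \<inter> Pre G (Xi (idx c) (rk (idx c) u) (jx (idx c) u))"
      if "Inv c u" "\<not> adv c u" "u \<notin> Pre G (Yi (idx c) (rk (idx c) u))" for c u
    proof -
      have "u \<in> Xi (idx c) (rk (idx c) u) (jx (idx c) u)" using that(1) jx unfolding Inv_def by blast
      then show ?thesis using that(2,3) Xi_unfold[of "idx c" "rk (idx c) u" "jx (idx c) u"]
        unfolding op_X_def adv_def by blast
    qed
    have pre: "u \<in> Pre G (D c u)" if "Inv c u" for c u
      using cases[OF that] unfolding D_def Let_def adv_def by auto
    have Yi_Q: "Yi i k \<subseteq> Q i" for i k
      unfolding Q_def using Yi_le[of i k] by (rule order_trans) blast
    have D_Q: "D c u \<subseteq> Q (idx c)" if "Inv c u" "\<not> adv c u" for c u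
    proof -
      have "Xi (idx c) (rk (idx c) u) (jx (idx c) u) \<subseteq> Yi (idx c) (Suc (rk (idx c) u))"
        unfolding Yi_Suc using that(1) jx unfolding Inv_def by blast
      then show ?thesis using Yi_Q that(2) unfolding D_def Let_def by (auto dest: subsetD)
    qed
    have inv: "Inv (upd c u) u'" if "Inv c u" "u' \<in> D c u" for c u u'
    proof (cases "adv c u")
      \<comment> \<open>\<open>Z\<close> lies in every \<open>Q i\<close>, so whichever guarantee
        comes next can be taken up.\<close>
      case True
      then show ?thesis using that(2) Z_Q[OF idx] unfolding Inv_def upd_def D_def by auto
    next
      case False
      then show ?thesis using D_Q[OF that(1)] that(2) unfolding Inv_def upd_def by auto
    qed
    have init: "Inv 0 v" unfolding Inv_def using v Z_Q[OF idx] unfolding Z_def by blast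
    obtain f where f: "strategy G f"
      "\<And>h u. reached G f v h u \<Longrightarrow> u \<in> states0 G \<Longrightarrow> f h u \<noteq> None"
      and run: "\<And>r. play G r \<Longrightarrow> r 0 = v \<Longrightarrow> follows G f r \<Longrightarrow>
        \<exists>c. \<forall>n. c (Suc n) = upd (c n) (r n) \<and> Inv (c n) (r n) \<and> r (Suc n) \<in> D (c n) (r n)"
      using memory_strategy[where Inv = Inv and D = D and upd = upd, OF graph init pre inv] by blast
    have "gr1 r" if r: "play G r" "r 0 = v" "follows G f r" for r
    proof -
      obtain c where c: "\<And>n. c (Suc n) = upd (c n) (r n)" "\<And>n. Inv (c n) (r n)"
        "\<And>n. r (Suc n) \<in> D (c n) (r n)" using run[OF r] by blast
      show ?thesis
      proof (cases "\<forall>k. \<exists>n\<ge>k. adv (c n) (r n)")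
        case True
        have "\<exists>l\<ge>k. r l \<in> N i" if "i \<in> {1..m}" for i k
          using counter_cycles[of c "\<lambda>n. adv (c n) (r n)" i m k] c(1) True that
          unfolding upd_def adv_def idx_def by auto
        then show ?thesis unfolding gr1_def by blast
      next
        case False
        then obtain K where K: "\<And>n. n \<ge> K \<Longrightarrow> \<not> adv (c n) (r n)" by blast
        define i where "i = idx (c K)"
        have const_c: "c n = c K" if "n \<ge> K" for n
          using that
        proof (induction n rule: dec_induct)
          case (step n)
          then show ?case using c(1)[of n] K[of n] by (simp add: upd_def)
        qed simp
        have idx_c: "idx (c n) = i" if "n \<ge> K" for n unfolding i_def const_c[OF that] ..
        have rQ: "r n \<in> Q i" if "n \<ge> K" for n
          using c(2)[of n] idx_c[OF that] unfolding Inv_def by simp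
        \<comment> \<open>The lexicographic order on pairs \<open>(rk, jx)\<close>, coded as a number.\<close>
        define p where "p n = rk i (r n) * Suc t + jx i (r n)" for n
        have jx_less: "jx i (r n) < Suc t" if "n \<ge> K" for n using jx[OF rQ[OF that]] by auto
        have lex: "p n' < p n" if "n' \<ge> K" "rk i (r n') < rk i (r n)" for n n'
        proof -
          have "Suc (rk i (r n')) * Suc t \<le> rk i (r n) * Suc t"
            using that(2) by (intro mult_le_mono1) simp
          then show ?thesis using jx_less[OF that(1)] unfolding p_def by simp
        qed
        have p_step: "p (Suc n) < p n \<or> p (Suc n) \<le> p n \<and> r n \<in> R (jx i (r n))" if n: "n \<ge> K" for n
        proof (cases "r n \<in> Pre G (Yi i (rk i (r n)))")
          case True
          then have "r (Suc n) \<in> Yi i (rk i (r n))"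
            using c(3)[of n] K[OF n] unfolding D_def Let_def idx_c[OF n] by simp
          \<comment> \<open>Rank 0 is impossible here, since the successor would lie in the empty
            \<open>Yi i 0\<close>; a positive rank drops because stage \<open>rk\<close> is
            \<open>Suc (rk - 1)\<close>.\<close>
          then have "rk i (r (Suc n)) < rk i (r n)"
            using rk_le[of "r (Suc n)" i "rk i (r n) - 1"] by (cases "rk i (r n)") (auto simp: Yi_def)
          then show ?thesis using lex n by simp
        next
          case False
          have j: "jx i (r n) \<in> {1..t}" using jx rQ[OF n] by blast
          have X: "r (Suc n) \<in> Xi i (rk i (r n)) (jx i (r n))"
            using c(3)[of n] K[OF n] False unfolding D_def Let_def idx_c[OF n] by simp
          then have "r (Suc n) \<in> Yi i (Suc (rk i (r n)))" using j unfolding Yi_Suc by blast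
          then have "rk i (r (Suc n)) \<le> rk i (r n)" by (rule rk_le)
          moreover have "p (Suc n) \<le> p n" if "rk i (r (Suc n)) = rk i (r n)"
            using jx_le[OF j] X that unfolding p_def by simp
          moreover have "r n \<in> R (jx i (r n))"
            using cases[OF c(2)[of n] K[OF n]] False unfolding idx_c[OF n] by blast
          ultimately show ?thesis using lex[of "Suc n" n] n by force
        qed
        \<comment> \<open>The code does not increase from \<open>K\<close> on, so it is constant
          once it attains its least value there.\<close>
        define q where "q = (LEAST q. \<exists>n\<ge>K. p n = q)"
        obtain n0 where n0: "n0 \<ge> K" "p n0 = q"
          using LeastI_ex[of "\<lambda>q. \<exists>n\<ge>K. p n = q"] unfolding q_def by blast
        have q_le: "q \<le> p n" if "n \<ge> K" for n
          unfolding q_def by (rule Least_le) (use that in blast)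
        have const: "p n = q" if "n \<ge> n0" for n
          using that
        proof (induction n rule: dec_induct)
          case (step n)
          then show ?case using p_step[of n] q_le[of "Suc n"] n0(1) by simp
        qed (rule n0(2))
        \<comment> \<open>A constant code leaves only the alternative inside \<open>R\<close>, and
          the index is its last digit in base \<open>Suc t\<close>.\<close>
        have "r n \<in> R (q mod Suc t)" if "n \<ge> n0" for n
        proof -
          have n: "n \<ge> K" using that n0(1) by simp
          have "jx i (r n) = q mod Suc t"
            using const[OF that] jx_less[OF n] unfolding p_def by (metis mod_less mod_mult_self3)
          then show ?thesis using p_step[OF n] const[of n] const[of "Suc n"] that by simp
        qed
        moreover have "q mod Suc t \<in> {1..t}"
          using n0(2) jx_less[OF n0(1)] jx[OF rQ[OF n0(1)]] unfolding p_def
          by (metis mod_less mod_mult_self3)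
        ultimately show ?thesis unfolding gr1_def by blast
      qed
    qed
    then show ?thesis unfolding winning_region_def winning_from_iff using f vV by blast
  qed
qed


section \<open>Winning states belong to the fixed point\<close>

lemma gr1_shift:
  assumes "gr1 r"
  shows "gr1 (\<lambda>n. r (Suc n))"
  using assms unfolding gr1_def
proof (elim disjE bexE exE)
  fix j k assume "j \<in> {1..t}" "\<forall>l\<ge>k. r l \<in> R j"
  moreover from this have "\<forall>l\<ge>k. r (Suc l) \<in> R j" by simp
  ultimately show "(\<exists>j\<in>{1..t}. \<exists>k. \<forall>l\<ge>k. r (Suc l) \<in> R j) \<or>
    (\<forall>i\<in>{1..m}. \<forall>k. \<exists>l\<ge>k. r (Suc l) \<in> N i)" by blast
next
  assume *: "\<forall>i\<in>{1..m}. \<forall>k. \<exists>l\<ge>k. r l \<in> N i"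
  have "\<exists>l\<ge>k. r (Suc l) \<in> N i" if i: "i \<in> {1..m}" for i k
  proof -
    obtain l where "l \<ge> Suc k" "r l \<in> N i" using * i by metis
    then show ?thesis by (cases l) auto
  qed
  then show "(\<exists>j\<in>{1..t}. \<exists>k. \<forall>l\<ge>k. r (Suc l) \<in> R j) \<or>
    (\<forall>i\<in>{1..m}. \<forall>k. \<exists>l\<ge>k. r (Suc l) \<in> N i)" by blast
qed

text \<open>Prefixing \<open>v\<close> turns plays of the residual strategy into plays of
  \<open>f\<close> from \<open>v\<close>, and by \<open>gr1_shift\<close> the objective survives the
  removal of that first state.\<close>

lemma winning_from_step:
  assumes f: "strategy G f" and w: "winning_from G (mt_formula S) f v"
    and step: "v \<in> states0 G \<Longrightarrow> f [] v = Some u" "v \<in> states1 G \<Longrightarrow> (v, u) \<in> edges G" and v: "v \<in> V"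
  shows "winning_from G (mt_formula S) (\<lambda>h. f (v # h)) u"
proof -
  let ?f = "\<lambda>h. f (v # h)"
  have "reached G f v [v] u"
    using v step reached.move0[OF reached.start, of v G f u] reached.move1[OF reached.start, of v G u f]
    unfolding states_def by auto
  have R: "reached G f v (v # h) u'" if "reached G ?f u h u'" for h u'
    using that
  proof induction
    case start
    then show ?case by (rule \<open>reached G f v [v] u\<close>)
  next
    case (move0 h w w')
    then show ?case using reached.move0[of G f v "v # h" w w'] by simp
  next
    case (move1 h w w')
    then show ?case using reached.move1[of G f v "v # h" w w'] by simp
  qed
  have e: "(v, u) \<in> edges G" using step v f unfolding states_def strategy_def by blast
  have "gr1 r" if r: "play G r" "r 0 = u" "follows G ?f r" for r
  proof -
    define r' where "r' = case_nat v r"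
    have r'_simps: "r' 0 = v" "r' (Suc n) = r n" for n unfolding r'_def by auto
    have hist: "map r' [0..<Suc n] = v # map r [0..<n]" for n
      by (induction n) (auto simp: r'_simps)
    have "(r' n, r' (Suc n)) \<in> edges G" for n
      using r(1,2) e unfolding play_def by (cases n) (auto simp: r'_simps)
    then have "play G r'" unfolding play_def by blast
    moreover have "f (map r' [0..<n]) (r' n) = Some (r' (Suc n))" if "r' n \<in> states0 G" for n
    proof (cases n)
      case 0
      then show ?thesis using that step(1) r(2) by (simp add: r'_simps)
    next
      case (Suc n')
      then show ?thesis using that r(3) unfolding follows_def Suc hist r'_simps by blast
    qed
    then have "follows G f r'" unfolding follows_def by blast
    ultimately have "gr1 r'" using w r'_simps(1) unfolding winning_from_iff by blast
    then show ?thesis using gr1_shift[of r'] unfolding r'_simps by simp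
  qed
  then show ?thesis using w R unfolding winning_from_iff by blast
qed

text \<open>Applying \<open>winning_from_step\<close> once per move shows that
  \<open>\<lambda>h'. f (h @ h')\<close> wins after each history \<open>h\<close>.\<close>

lemma reached_winning:
  assumes f: "strategy G f" and w: "winning_from G (mt_formula S) f v" and v: "v \<in> V"
    and R: "reached G f v h u"
  shows "u \<in> W"
proof -
  have strat: "strategy G (\<lambda>h'. f (h @ h'))" for h
    unfolding strategy_def
  proof (intro allI impI)
    fix h' w w' assume "f (h @ h') w = Some w'"
    then have "h @ h' \<in> lists V \<and> w \<in> states0 G \<and> (w, w') \<in> edges G"
      using f unfolding strategy_def by blast
    then show "h' \<in> lists V \<and> w \<in> states0 G \<and> (w, w') \<in> edges G" by simp
  qed
  have E: "edges G \<subseteq> V \<times> V" using graph unfolding game_graph_def by blast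
  have disj: "states0 G \<inter> states1 G = {}" using graph unfolding game_graph_def by blast
  have "u \<in> V \<and> winning_from G (mt_formula S) (\<lambda>h'. f (h @ h')) u"
    using R
  proof induction
    case start
    then show ?case using v w by simp
  next
    case (move0 h u u')
    then have w: "winning_from G (mt_formula S) (\<lambda>h'. f (h @ h')) u" and u: "u \<in> V" by blast+
    have "u \<notin> states1 G" using move0.hyps disj by blast
    then have "winning_from G (mt_formula S) (\<lambda>h'. f (h @ u # h')) u'"
      using winning_from_step[OF strat w _ _ u, of u'] move0.hyps by simp
    moreover have "(u, u') \<in> edges G" using f move0.hyps unfolding strategy_def by blast
    ultimately show ?case using E by auto
  next
    case (move1 h u u')
    then have w: "winning_from G (mt_formula S) (\<lambda>h'. f (h @ h')) u" and u: "u \<in> V" by blast+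
    have "u \<notin> states0 G" using move1.hyps disj by blast
    then have "winning_from G (mt_formula S) (\<lambda>h'. f (h @ u # h')) u'"
      using winning_from_step[OF strat w _ _ u, of u'] move1.hyps by simp
    then show ?case using E move1.hyps by auto
  qed
  then show ?thesis using strat unfolding winning_region_def by blast
qed

text \<open>By contradiction: from a state of \<open>W\<close> outside
  \<open>lfp (op_Y i W)\<close>, player 1 cycles through the indices \<open>j\<close>. The stages
  approximating \<open>gfp (op_X i j W Q)\<close> give a rank that decreases until the play leaves
  \<open>R j\<close>, while \<open>reached_winning\<close> implies that the play never leaves mode
  \<open>i\<close>.\<close>

lemma winning_region_le_op_Z: "W \<subseteq> op_Z W"
proof
  fix v assume "v \<in> W"
  then obtain f where v: "v \<in> V" and f: "strategy G f" and w: "winning_from G (mt_formula S) f v"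
    by (auto simp: winning_region_def)
  have "v \<in> lfp (op_Y i W)" if i: "i \<in> {1..m}" for i
  proof (rule ccontr)
    define Q where "Q = lfp (op_Y i W)"
    have Q: "gfp (op_X i j W Q) \<subseteq> Q" if "j \<in> {1..t}" for j
    proof -
      have "op_Y i W Q = Q" unfolding Q_def by (rule lfp_unfold[OF mono_op_Y, symmetric])
      then show ?thesis using that unfolding op_Y_def by blast
    qed
    assume "v \<notin> lfp (op_Y i W)"
    then have vQ: "v \<notin> Q" unfolding Q_def .
    have t: "t > 0" using i targets by auto
    define idx where "idx c = Suc (c mod t)" for c
    have idx: "idx c \<in> {1..t}" for c
      unfolding idx_def using t by (simp add: Suc_leI)
    define X where "X j k = (op_X i j W Q ^^ k) V" for j k
    have gfp_X: "gfp (op_X i j W Q) = (\<Inter>k. X j k)" for j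
      unfolding nu_op_X[symmetric] nu_def X_def ..
    \<comment> \<open>The last stage still containing \<open>u\<close>; as \<open>X j 0\<close> is
      \<open>V\<close>, a state of \<open>V\<close> can drop out only at a successor stage.\<close>
    define rk where "rk j u = (LEAST k. u \<notin> X j (Suc k))" for j u
    have rk_le: "rk j u \<le> k" if "u \<notin> X j (Suc k)" for j u k
      unfolding rk_def by (rule Least_le) (rule that)
    define adv where "adv c u \<longleftrightarrow> u \<notin> R (idx c)" for c u
    \<comment> \<open>By \<open>out\<close>, \<open>u\<close> fails every disjunct of
      \<open>op_X\<close>. So \<open>Q\<close> can be avoided, which yields a rank for the next
      index; inside \<open>R\<close> the current stage can be avoided too, which lowers the
      rank.\<close>
    define D where "D c u = (if adv c u then Q else X (idx c) (rk (idx c) u))" for c u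
    define upd where "upd c u = (if adv c u then Suc c else c)" for c u
    define Inv where "Inv c u \<longleftrightarrow> u \<in> V \<and> (\<exists>k. u \<notin> X (idx c) (Suc k))" for c u
    have InvI: "Inv c u" if "u \<in> V" "u \<notin> X (idx c) k" for c u k
      using that unfolding Inv_def by (cases k) (auto simp: X_def)
    have out: "u \<notin> op_X i (idx c) W Q (X (idx c) (rk (idx c) u))" if "Inv c u" for c u
      using LeastI_ex[of "\<lambda>k. u \<notin> X (idx c) (Suc k)"] that unfolding Inv_def rk_def[symmetric]
      by (auto simp: X_def)
    have pre: "u \<in> V - Pre G (D c u)" if "Inv c u" for c u
      using out[OF that] that unfolding op_X_def D_def adv_def Inv_def by auto
    have inv: "Inv (upd c u) u'" if "Inv c u" "u' \<in> V - D c u" for c u u'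
    proof (cases "adv c u")
      case True
      then have "u' \<notin> gfp (op_X i (idx (Suc c)) W Q)" using that(2) Q[OF idx] unfolding D_def by auto
      then show ?thesis using True that(2) InvI unfolding gfp_X upd_def by auto
    next
      case False
      then show ?thesis using that(2) InvI unfolding D_def upd_def by auto
    qed
    have init: "Inv 0 v" using vQ Q[OF idx] v InvI unfolding gfp_X by blast
    have defined: "f h u \<noteq> None" if "reached G f v h u" "u \<in> states0 G" for h u
      using w that unfolding winning_from_def by blast
    obtain r c where r: "play G r" "r 0 = v" "follows G f r"
      and reached: "\<And>n. reached G f v (map r [0..<n]) (r n)"
      and c: "\<And>n. c (Suc n) = upd (c n) (r n)" "\<And>n. Inv (c n) (r n)"
      and rD: "\<And>n. r (Suc n) \<in> V - D (c n) (r n)"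
      by (rule spoiling_play[where Inv = Inv and D = D and upd = upd, OF graph f init])
        (erule (1) defined, erule pre, erule (1) inv, blast)
    \<comment> \<open>In \<open>N i\<close>, failure of the last disjunct means being outside
      \<open>Pre G W\<close>; but the move of \<open>f\<close>, or every move of player 1, leads to
      a reached and hence winning state.\<close>
    have rN: "r n \<notin> N i" for n
    proof
      assume "r n \<in> N i"
      then have "r n \<notin> Pre G W" using out[OF c(2)[of n]] unfolding op_X_def by blast
      have "r n \<in> V" by (rule play_in_states[OF graph r(1)])
      then consider "r n \<in> states0 G" | "r n \<in> states1 G" unfolding states_def by blast
      then show False
      proof cases
        case 1
        have "r (Suc n) \<in> W" by (rule reached_winning[OF f w v reached])
        then show False using 1 r(1) \<open>r n \<notin> Pre G W\<close> unfolding Pre_def play_def by blast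
      next
        case 2
        have "u' \<in> W" if "(r n, u') \<in> edges G" for u'
          using reached_winning[OF f w v reached.move1[OF reached 2 that]] .
        then show False using 2 \<open>r n \<notin> Pre G W\<close> unfolding Pre_def by blast
      qed
    qed
    \<comment> \<open>Otherwise the index is eventually fixed and the rank decreases strictly
      forever.\<close>
    have inf: "\<exists>n\<ge>k. adv (c n) (r n)" for k
    proof (rule ccontr)
      assume "\<not> ?thesis"
      then have K: "\<not> adv (c n) (r n)" if "n \<ge> k" for n using that by blast
      have const: "c n = c k" if "n \<ge> k" for n
        using that
      proof (induction n rule: dec_induct)
        case (step n)
        then show ?case using c(1)[of n] K[of n] by (simp add: upd_def)
      qed simp
      define p where "p n = rk (idx (c k)) (r (k + n))" for n
      have p_less: "p (Suc n) < p n" for n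
      proof -
        have notX: "r (Suc (k + n)) \<notin> X (idx (c k)) (p n)"
          using rD[of "k + n"] K[of "k + n"] const[of "k + n"] unfolding D_def p_def by simp
        \<comment> \<open>\<open>p n\<close> is positive because stage 0 is all of
          \<open>V\<close>.\<close>
        then obtain q where q: "p n = Suc q"
          using rD[of "k + n"] by (cases "p n") (auto simp: X_def)
        then have "p (Suc n) \<le> q" using notX rk_le[of "r (Suc (k + n))"] unfolding p_def by simp
        then show ?thesis using q by simp
      qed
      have "p n + n \<le> p 0" for n
      proof (induction n)
        case (Suc n)
        then show ?case using p_less[of n] by simp
      qed simp
      from this[of "Suc (p 0)"] show False by simp
    qed
    have "\<exists>l\<ge>k. r l \<notin> R j" if "j \<in> {1..t}" for j k
      using counter_cycles[of c "\<lambda>n. adv (c n) (r n)" j t k] c(1) inf that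
      unfolding upd_def adv_def idx_def by auto
    then have "\<not> gr1 r" using rN i unfolding gr1_def by blast
    then show False using w r unfolding winning_from_iff by blast
  qed
  then show "v \<in> op_Z W" unfolding op_Z_def using v by blast
qed

lemma gfp_op_Z: "gfp op_Z = W"
proof
  show "gfp op_Z \<subseteq> W" using fixpoint_winning by (rule subsetI)
  show "W \<subseteq> gfp op_Z" using winning_region_le_op_Z by (rule gfp_upperbound)
qed

end


section \<open>Evaluation and its cost\<close>

text \<open>The loop stops only after one unchanged iteration from \<open>B N\<close>, so
  \<open>P\<close> ends at \<open>Suc N\<close> while the result is \<open>B N\<close>.\<close>

lemma iterate_run:
  assumes run: "\<And>k s. k \<le> N \<Longrightarrow> P k s \<Longrightarrow> \<exists>s'. F k (B k) s = Some (B (Suc k), s') \<and> P (Suc k) s'"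
    and ne: "\<And>k. k < N \<Longrightarrow> B (Suc k) \<noteq> B k" and stable: "B (Suc N) = B N"
    and P: "P k s" and k: "k \<le> N"
  shows "\<exists>s'. iterate F k (B k) s = Some (B N, s') \<and> P (Suc N) s'"
  using k P
proof (induction k arbitrary: s rule: inc_induct)
  case base
  then obtain s' where "F N (B N) s = Some (B N, s')" "P (Suc N) s'"
    using run[of N s] stable by auto
  then show ?case by (subst iterate.simps) simp
next
  case (step k)
  then obtain s' where s': "F k (B k) s = Some (B (Suc k), s')" "P (Suc k) s'"
    using run[of k s] by auto
  then show ?case using step.IH[OF s'(2)] ne[OF step.hyps(2)]
    by (subst iterate.simps) simp
qed

text \<open>\<open>P c s\<close> stands for an invariant with budget \<open>c\<close>, to which each
  list element adds \<open>d\<close>.\<close>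

lemma union_over_run:
  assumes "\<And>j c s. j \<in> set js \<Longrightarrow> P c s \<Longrightarrow> \<exists>s'. F j s = Some (U j, s') \<and> P (c + d) s'" and "P c s"
  shows "\<exists>s'. union_over F js s = Some (\<Union>j\<in>set js. U j, s') \<and> P (c + d * length js) s'"
  using assms
proof (induction js arbitrary: c s)
  case (Cons j js)
  obtain s' where s': "F j s = Some (U j, s')" "P (c + d) s'"
    using Cons.prems(1)[of j c s] Cons.prems(2) by auto
  obtain s'' where "union_over F js s' = Some (\<Union>j\<in>set js. U j, s'')" "P (c + d + d * length js) s''"
    using Cons.IH[OF _ s'(2)] Cons.prems(1) by auto
  then show ?case using s' by (simp add: add.assoc)
qed simp

lemma inter_over_run:
  assumes "\<And>j c s. j \<in> set js \<Longrightarrow> P c s \<Longrightarrow> \<exists>s'. F j s = Some (U j, s') \<and> P (c + d) s'" and "P c s"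
  shows "\<exists>s'. inter_over A F js s = Some (A \<inter> (\<Inter>j\<in>set js. U j), s') \<and> P (c + d * length js) s'"
  using assms
proof (induction js arbitrary: c s)
  case (Cons j js)
  obtain s' where s': "F j s = Some (U j, s')" "P (c + d) s'"
    using Cons.prems(1)[of j c s] Cons.prems(2) by auto
  obtain s'' where "inter_over A F js s' = Some (A \<inter> (\<Inter>j\<in>set js. U j), s'')"
    "P (c + d + d * length js) s''"
    using Cons.IH[OF _ s'(2)] Cons.prems(1) by auto
  then show ?case using s' by (simp add: add.assoc Int_left_commute)
qed simp

section \<open>Amortized cost of the evaluation\<close>

context mode_target_game
begin

definition iter_Y :: "nat \<Rightarrow> 'v set \<Rightarrow> nat \<Rightarrow> 'v set" where
  "iter_Y i Z k = (op_Y i Z ^^ k) {}"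

text \<open>The iteration of \<open>Y\<close> has at most \<open>card V\<close> growing steps and
  one that detects stability, hence \<open>k\<close> from 0 to \<open>card V\<close>.\<close>

definition slots :: "(nat \<times> nat \<times> nat) set" where
  "slots = {1..m} \<times> {..card V} \<times> {1..t}"

text \<open>
  Storing a smaller set pays for the iterations that shrank it, so that a single evaluation of \<open>X\<close>
  costs only the three calls of its last iteration, which detects stability.
\<close>

definition potential :: "'v eval_state \<Rightarrow> nat" where
  "potential s = pre_calls s + 3 * (\<Sum>(i, k, j)\<in>slots. card (stored s i k j))"

text \<open>The starting sets from which \<open>decreasing_iteration\<close> reaches
  \<open>gfp F\<close>.\<close>

definition admissible :: "('v set \<Rightarrow> 'v set) \<Rightarrow> 'v set \<Rightarrow> bool" where
  "admissible F A \<longleftrightarrow> A \<subseteq> V \<and> F A \<subseteq> A \<and> gfp F \<subseteq> A"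

text \<open>Each stored value is tied to \<open>iter_Y i Z k\<close>, the \<open>Y\<close> for which
  it will serve as a start under the current \<open>Z\<close>.\<close>

definition invariant :: "'v set \<Rightarrow> nat \<Rightarrow> 'v eval_state \<Rightarrow> bool" where
  "invariant Z c s \<longleftrightarrow>
     (\<forall>i k j. admissible (op_X i j Z (iter_Y i Z k)) (stored s i k j)) \<and> potential s \<le> c"

lemma iter_Y_mono: "Z \<subseteq> Z' \<Longrightarrow> iter_Y i Z k \<subseteq> iter_Y i Z' k"
  unfolding iter_Y_def by (induction k) (auto intro: subsetD[OF op_Y_mono])

text \<open>This justifies reusing stored values: a smaller \<open>Z\<close> shrinks the stage of
  \<open>Y\<close> with the same number \<open>k\<close>, hence also \<open>op_X\<close> and its
  greatest fixed point, so old values remain valid starts.\<close>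

lemma invariant_antimono:
  assumes "Z \<subseteq> Z'" "invariant Z' c s"
  shows "invariant Z c s"
proof -
  have "op_X i j Z (iter_Y i Z k) A \<subseteq> op_X i j Z' (iter_Y i Z' k) A" for i j k A
    by (intro op_X_mono assms(1) iter_Y_mono order_refl)
  moreover have "gfp (op_X i j Z (iter_Y i Z k)) \<subseteq> gfp (op_X i j Z' (iter_Y i Z' k))" for i j k
    by (intro gfp_op_X_mono assms(1) iter_Y_mono)
  ultimately show ?thesis using assms(2) unfolding invariant_def admissible_def
    by (meson order_trans)
qed

lemma eval_body_run:
  "eval_body G S i j Z Y X s = Some (op_X i j Z Y X, s\<lparr>pre_calls := pre_calls s + 3\<rparr>)"
  by (simp add: eval_body_def call_pre_def op_X_def)

lemma iterate_body_run:
  assumes A: "admissible (op_X i j Z Y) A"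
  obtains N where "iterate (\<lambda>_. eval_body G S i j Z Y) 0 A s =
      Some (gfp (op_X i j Z Y), s\<lparr>pre_calls := pre_calls s + 3 * Suc N\<rparr>)"
    and "N + card (gfp (op_X i j Z Y)) \<le> card A"
proof -
  let ?F = "op_X i j Z Y"
  have "finite A" using A fin finite_subset unfolding admissible_def by blast
  then obtain N where N: "(?F ^^ N) A = gfp ?F" "\<And>k. k < N \<Longrightarrow> (?F ^^ Suc k) A \<noteq> (?F ^^ k) A"
    "N + card (gfp ?F) \<le> card A"
    using decreasing_iteration[OF mono_op_X, of A i j Z Y] A unfolding admissible_def by blast
  have "(?F ^^ Suc N) A = (?F ^^ N) A"
    using N(1) gfp_unfold[OF mono_op_X, of i j Z Y] by simp
  then have "\<exists>s'. iterate (\<lambda>_. eval_body G S i j Z Y) 0 ((?F ^^ 0) A) s = Some ((?F ^^ N) A, s') \<and>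
    s' = s\<lparr>pre_calls := pre_calls s + 3 * Suc N\<rparr>"
    by (intro iterate_run[where B = "\<lambda>k. (?F ^^ k) A"
          and P = "\<lambda>k s'. s' = s\<lparr>pre_calls := pre_calls s + 3 * k\<rparr>"] N(2))
      (auto simp: eval_body_run)
  then show thesis using that[of N] N(1,3) by simp
qed

text \<open>Of the \<open>3 * Suc N\<close> calls, \<open>3 * N\<close> are offset by the potential
  released when the slot loses at least \<open>N\<close> elements; the other slots are
  untouched.\<close>

lemma eval_X_run:
  assumes inv: "invariant Z c s" and slot: "(i, k, j) \<in> slots"
  shows "\<exists>s'. eval_X G S i k j Z (iter_Y i Z k) s = Some (gfp (op_X i j Z (iter_Y i Z k)), s') \<and>
    invariant Z (c + 3) s'"
proof -
  let ?F = "op_X i j Z (iter_Y i Z k)"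
  have adm: "admissible ?F (stored s i k j)" using inv unfolding invariant_def by blast
  obtain N where N: "iterate (\<lambda>_. eval_body G S i j Z (iter_Y i Z k)) 0 (stored s i k j) s =
      Some (gfp ?F, s\<lparr>pre_calls := pre_calls s + 3 * Suc N\<rparr>)"
    and card: "N + card (gfp ?F) \<le> card (stored s i k j)"
    using iterate_body_run[OF adm] .
  define st where "st = (stored s)(i := (stored s i)(k := (stored s i k)(j := gfp ?F)))"
  define s' where "s' = s\<lparr>pre_calls := pre_calls s + 3 * Suc N, stored := st\<rparr>"
  have ev: "eval_X G S i k j Z (iter_Y i Z k) s = Some (gfp ?F, s')"
    unfolding eval_X_def N s'_def st_def by simp
  have st: "st i' k' j' = (if (i', k', j') = (i, k, j) then gfp ?F else stored s i' k' j')" for i' k' j'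
    unfolding st_def by simp
  have "admissible ?F (gfp ?F)"
    unfolding admissible_def using gfp_op_X_subset gfp_unfold[OF mono_op_X, of i j] by blast
  then have "\<forall>i' k' j'. admissible (op_X i' j' Z (iter_Y i' Z k')) (stored s' i' k' j')"
    using inv unfolding invariant_def s'_def by (simp add: st)
  moreover have "potential s' \<le> potential s + 3"
  proof -
    have finS: "finite slots" unfolding slots_def by simp
    let ?R = "\<lambda>f. \<Sum>(i, k, j)\<in>slots - {(i, k, j)}. card (f i k j)"
    have split: "(\<Sum>(i, k, j)\<in>slots. card (f i k j)) = card (f i k j) + ?R f" for f :: "_ \<Rightarrow> _ \<Rightarrow> _ \<Rightarrow> 'v set"
      using sum.remove[OF finS slot, of "\<lambda>(i, k, j). card (f i k j)"] by simp
    have "?R st = ?R (stored s)"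
      by (rule sum.cong[OF refl]) (auto simp: st split: if_splits)
    then show ?thesis unfolding potential_def split s'_def using card by (simp add: st)
  qed
  ultimately have "invariant Z (c + 3) s'" using inv unfolding invariant_def by simp
  then show ?thesis using ev by blast
qed

lemma eval_Y_run:
  assumes inv: "invariant Z c s" and i: "i \<in> {1..m}"
  shows "\<exists>s'. eval_Y G S i Z s = Some (lfp (op_Y i Z), s') \<and> invariant Z (c + 3 * t * Suc (card V)) s'"
proof -
  have finL: "finite (lfp (op_Y i Z))" by (rule finite_subset[OF lfp_op_Y_subset fin])
  obtain N where N: "iter_Y i Z N = lfp (op_Y i Z)"
    "\<And>k. k < N \<Longrightarrow> iter_Y i Z (Suc k) \<noteq> iter_Y i Z k" "N \<le> card (lfp (op_Y i Z))"
    using increasing_iteration[OF mono_op_Y finL] unfolding iter_Y_def by blast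
  \<comment> \<open>This keeps all iteration numbers \<open>k \<le> N\<close> inside
    \<open>slots\<close>.\<close>
  have Nn: "N \<le> card V" using N(3) card_mono[OF fin lfp_op_Y_subset, of i Z] by simp
  have Suc: "iter_Y i Z (Suc k) = (\<Union>j\<in>{1..t}. gfp (op_X i j Z (iter_Y i Z k)))" for k
    unfolding iter_Y_def by (simp add: op_Y_def)
  let ?F = "\<lambda>k Y. union_over (\<lambda>j. eval_X G S i k j Z Y) [1..<Suc t]"
  have run: "\<exists>s'. ?F k (iter_Y i Z k) s = Some (iter_Y i Z (Suc k), s') \<and>
    invariant Z (c + 3 * t * Suc k) s'" if "k \<le> N" "invariant Z (c + 3 * t * k) s" for k s
  proof -
    have "\<exists>s'. ?F k (iter_Y i Z k) s = Some (\<Union>j\<in>set [1..<Suc t]. gfp (op_X i j Z (iter_Y i Z k)), s') \<and>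
      invariant Z (c + 3 * t * k + 3 * length [1..<Suc t]) s'"
      using that i Nn
      by (intro union_over_run eval_X_run) (auto simp: slots_def)
    then show ?thesis
      by (simp add: Suc atLeastLessThanSuc_atLeastAtMost algebra_simps del: upt_Suc)
  qed
  have "iter_Y i Z (Suc N) = iter_Y i Z N"
    unfolding N(1) using lfp_unfold[OF mono_op_Y, of i Z] N(1) unfolding iter_Y_def by simp
  then have "\<exists>s'. iterate ?F 0 (iter_Y i Z 0) s = Some (iter_Y i Z N, s') \<and>
    invariant Z (c + 3 * t * Suc N) s'"
    by (intro iterate_run[where P = "\<lambda>k. invariant Z (c + 3 * t * k)"] run N(2)) (use inv in auto)
  moreover have "invariant Z (c + 3 * t * Suc (card V)) s'" if "invariant Z (c + 3 * t * Suc N) s'" for s'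
  proof -
    have "3 * t * Suc N \<le> 3 * t * Suc (card V)" using Nn by (intro mult_le_mono2) simp
    then show ?thesis using that unfolding invariant_def by (meson add_left_mono order_trans)
  qed
  ultimately show ?thesis unfolding eval_Y_def N(1) by (auto simp: iter_Y_def)
qed

lemma GR1_Emb_run:
  "\<exists>s. GR1_Emb G S = Some (gfp op_Z, s) \<and>
     pre_calls s \<le> 3 * m * t * Suc (card V) * (2 * card V + 1)"
proof -
  define n where "n = card V"
  define s0 where "s0 = \<lparr>pre_calls = 0, stored = (\<lambda>_ _ _. V)\<rparr>"
  \<comment> \<open>The initial potential: \<open>m * t * Suc n\<close> slots, each holding all
    \<open>n\<close> states.\<close>
  define c0 where "c0 = 3 * m * t * Suc n * n"
  \<comment> \<open>The budget for one iteration of \<open>Z\<close>: \<open>m\<close> modes, at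
    most \<open>Suc n\<close> iterations of \<open>Y\<close>, \<open>t\<close> indices and 3
    amortized calls each.\<close>
  define d where "d = 3 * t * Suc n * m"
  have le: "gfp op_Z \<subseteq> V" using op_Z_subset gfp_unfold[OF mono_op_Z] by metis
  obtain N where N: "(op_Z ^^ N) V = gfp op_Z" "\<And>k. k < N \<Longrightarrow> (op_Z ^^ Suc k) V \<noteq> (op_Z ^^ k) V"
    "N + card (gfp op_Z) \<le> card V"
    using decreasing_iteration[OF mono_op_Z fin op_Z_subset le] by blast
  have "potential s0 = c0"
    unfolding potential_def s0_def slots_def c0_def n_def by (simp add: algebra_simps)
  then have init: "invariant V c0 s0"
    unfolding invariant_def admissible_def s0_def using op_X_subset gfp_op_X_subset by simp
  let ?F = "\<lambda>_::nat. \<lambda>Z. inter_over V (\<lambda>i. eval_Y G S i Z) [1..<Suc m]"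
  have run: "\<exists>s'. ?F k ((op_Z ^^ k) V) s = Some ((op_Z ^^ Suc k) V, s') \<and>
    invariant ((op_Z ^^ Suc k) V) (c0 + d * Suc k) s'"
    if "invariant ((op_Z ^^ k) V) (c0 + d * k) s" for k s
  proof -
    let ?Z = "(op_Z ^^ k) V"
    have "\<exists>s'. ?F k ?Z s = Some (V \<inter> (\<Inter>i\<in>set [1..<Suc m]. lfp (op_Y i ?Z)), s') \<and>
      invariant ?Z (c0 + d * k + 3 * t * Suc (card V) * length [1..<Suc m]) s'"
      using that by (intro inter_over_run eval_Y_run) auto
    then obtain s' where s': "?F k ?Z s = Some (op_Z ?Z, s')" "invariant ?Z (c0 + d * Suc k) s'"
      unfolding op_Z_def d_def n_def
      by (auto simp: atLeastLessThanSuc_atLeastAtMost algebra_simps simp del: upt_Suc)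
    \<comment> \<open>The next iterate of \<open>Z\<close> is contained in this one, so the stored
      values carry over.\<close>
    then show ?thesis
      using invariant_antimono[OF funpow_decreasing[OF mono_op_Z op_Z_subset]] by simp
  qed
  have "(op_Z ^^ Suc N) V = (op_Z ^^ N) V"
    using N(1) gfp_unfold[OF mono_op_Z] by simp
  then have "\<exists>s'. iterate ?F 0 ((op_Z ^^ 0) V) s0 = Some ((op_Z ^^ N) V, s') \<and>
    invariant ((op_Z ^^ Suc N) V) (c0 + d * Suc N) s'"
    by (intro iterate_run[where B = "\<lambda>k. (op_Z ^^ k) V"
          and P = "\<lambda>k. invariant ((op_Z ^^ k) V) (c0 + d * k)"] run N(2)) (use init in auto)
  then obtain s where s: "GR1_Emb G S = Some (gfp op_Z, s)" "potential s \<le> c0 + d * Suc N"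
    unfolding GR1_Emb_def eval_Z_def s0_def[symmetric] N(1) invariant_def by auto
  have "pre_calls s \<le> potential s" unfolding potential_def by simp
  also have "\<dots> \<le> c0 + d * Suc N" by (rule s(2))
  also have "\<dots> \<le> c0 + d * Suc n" using N(3) unfolding n_def by (intro add_left_mono mult_le_mono2) simp
  also have "\<dots> = 3 * m * t * Suc n * (2 * n + 1)" unfolding c0_def d_def by (simp add: algebra_simps)
  finally show ?thesis using s(1) unfolding n_def by blast
qed

lemma GR1_Emb_cost:
  assumes "V \<noteq> {}" "GR1_Emb G S = Some (A, s)"
  shows "pre_calls s \<le> 18 * (m * t * (card V)\<^sup>2)"
proof -
  have n: "card V \<ge> 1" using assms(1) fin by (simp add: Suc_le_eq card_gt_0_iff)
  have "pre_calls s \<le> 3 * m * t * (Suc (card V) * (2 * card V + 1))"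
    using GR1_Emb_run assms(2) unfolding mult.assoc by auto
  \<comment> \<open>For \<open>n \<ge> 1\<close>, \<open>n + 1 \<le> 2 * n\<close> and
    \<open>2 * n + 1 \<le> 3 * n\<close>, which gives the constant
    \<open>3 * 2 * 3 = 18\<close>.\<close>
  also have "\<dots> \<le> 3 * m * t * ((2 * card V) * (3 * card V))"
    using n by (intro mult_le_mono) auto
  also have "\<dots> = 18 * (m * t * (card V)\<^sup>2)" by (simp add: power2_eq_square)
  finally show ?thesis .
qed

end

theorem theorem6:
  "\<exists>C :: nat. \<forall>(G :: ('v, 'p) game_graph) (S :: 'p mode_target).
     mt_game G S \<and> (nmodes S > 0 \<longrightarrow> max_targets S > 0) \<longrightarrow>
     gr1_fixpoint G S = winning_region G (mt_formula S) \<and>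
     (\<exists>s. GR1_Emb G S = Some (winning_region G (mt_formula S), s) \<and>
        (states G \<noteq> {} \<longrightarrow>
           pre_calls s \<le> C * (nmodes S * max_targets S * (card (states G))\<^sup>2)))"
proof (intro exI[of _ 18] allI impI)
  fix G :: "('v, 'p) game_graph" and S :: "'p mode_target"
  assume "mt_game G S \<and> (nmodes S > 0 \<longrightarrow> max_targets S > 0)"
  then interpret mode_target_game G S by unfold_locales auto
  obtain s where s: "GR1_Emb G S = Some (W, s)" using GR1_Emb_run gfp_op_Z by auto
  show "gr1_fixpoint G S = W \<and> (\<exists>s. GR1_Emb G S = Some (W, s) \<and>
    (V \<noteq> {} \<longrightarrow> pre_calls s \<le> 18 * (m * t * (card V)\<^sup>2)))"
    using gr1_fixpoint_eq gfp_op_Z s GR1_Emb_cost[OF _ s] by auto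
qed

end
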